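(* Let $c>0$. Every one-parametric subgroup of the Lie group $K^+_c$ is of the form \[ \phi_{a,b}\colon \mathbb R\to K^+_c,\qquad \phi_{a,b}(s)=\exp(as)\,\mathrm L_c^{bs},\qquad s\in\mathbb R, \] where $a,b$ are real parameters.
   Context: For a fixed real number $c>0$ (the speed of light), $K^+_c$ is the group, under matrix multiplication, of all real $2\times 2$ matrices \[ \mathrm A_c(a,b)=\begin{pmatrix} a & b\\ \frac{b}{c^2} & a\end{pmatrix},\qquad a,b\in\mathbb R,\quad a^2-\frac{b^2}{c^2}>0,\quad a>0 . \] It is a commutative Lie subgroup of $GL(2,\mathbb R)$. For $s\in\mathbb R$, \[ \mathrm L_c^s=\begin{pmatrix}\cosh s & c\sinh s\\ \frac1c\sinh s & \cosh s\end{pmatrix}. \] In $\exp(as)\,\mathrm L_c^{bs}$, $\exp(as)$ is the real exponential, acting as a scalar factor. A one-parametric subgroup of a Lie group $(G,\cdot)$ is a smooth mapping $\phi\colon\mathbb R\to G$, $s\mapsto g^s$, such that $g^0$ is the neutral element of $G$ and $g^s\cdot g^{s'}=g^{s+s'}$ for all $s,s'\in\mathbb R$. *)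

theory Defs
  imports "HOL-Analysis.Analysis" "HOL-Algebra.Group"
begin

definition A_mat :: "real \<Rightarrow> real \<Rightarrow> real \<Rightarrow> real^2^2" where
  "A_mat c a b = vector [vector [a, b], vector [b / c\<^sup>2, a]]"

definition L_mat :: "real \<Rightarrow> real \<Rightarrow> real^2^2" where
  "L_mat c s = vector [vector [cosh s, c * sinh s], vector [(1 / c) * sinh s, cosh s]]"

definition K_plus :: "real \<Rightarrow> (real^2^2) monoid" where
  "K_plus c =
    \<lparr>carrier = {A_mat c a b | a b. a\<^sup>2 - b\<^sup>2 / c\<^sup>2 > 0 \<and> a > 0},
     monoid.mult = (**),
     one = mat 1\<rparr>"

definition smooth_curve :: "(real \<Rightarrow> 'a::real_normed_vector) \<Rightarrow> bool" where
  "smooth_curve f \<longleftrightarrow>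
    (\<forall>n t. ((\<lambda>g x. vector_derivative g (at x)) ^^ n) f differentiable (at t))"

text \<open>
  The library has no manifolds, so smoothness of a curve in a matrix Lie group is
  smoothness as a curve in the ambient space of matrices. For \<open>K_plus c\<close> this is
  smoothness for its manifold structure: the carrier is open in a linear subspace
  (lemmas \<open>subspace_A_mat\<close> and \<open>openin_K_plus\<close> below), on which \<open>a\<close> and \<open>b\<close> are linear
  coordinates.
\<close>

definition one_parametric_subgroup ::
    "(real^'n^'n) monoid \<Rightarrow> (real \<Rightarrow> real^'n^'n) \<Rightarrow> bool" where
  "one_parametric_subgroup G \<phi> \<longleftrightarrow>
    \<phi> \<in> UNIV \<rightarrow> carrier G \<and>
    smooth_curve \<phi> \<and>
    \<phi> 0 = \<one>\<^bsub>G\<^esub> \<and>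
    (\<forall>s s'. \<phi> s \<otimes>\<^bsub>G\<^esub> \<phi> s' = \<phi> (s + s'))"

definition phi :: "real \<Rightarrow> real \<Rightarrow> real \<Rightarrow> real \<Rightarrow> real^2^2" where
  "phi c a b s = exp (a * s) *\<^sub>R L_mat c (b * s)"

lemma A_mat_nth [simp]:
  "A_mat c a b $ 1 $ 1 = a" "A_mat c a b $ 1 $ 2 = b"
  "A_mat c a b $ 2 $ 1 = b / c\<^sup>2" "A_mat c a b $ 2 $ 2 = a"
  by (simp_all add: A_mat_def)

lemma A_mat_mult:
  "A_mat c a b ** A_mat c a' b' = A_mat c (a * a' + b * b' / c\<^sup>2) (a * b' + b * a')"
  by (simp add: vec_eq_iff forall_2 matrix_matrix_mult_def sum_2 field_simps add_divide_distrib)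

lemma A_mat_one: "A_mat c 1 0 = mat 1"
  by (simp add: vec_eq_iff forall_2 mat_def)

lemma A_mat_norm_mult:
  fixes c :: real
  assumes "c > 0"
  shows "(a * a' + b * b' / c\<^sup>2)\<^sup>2 - (a * b' + b * a')\<^sup>2 / c\<^sup>2 =
    (a\<^sup>2 - b\<^sup>2 / c\<^sup>2) * (a'\<^sup>2 - b'\<^sup>2 / c\<^sup>2)"
  using assms by (simp add: field_simps power2_eq_square)

lemma A_mat_in_K_plus:
  "A_mat c a b \<in> carrier (K_plus c) \<longleftrightarrow> a\<^sup>2 - b\<^sup>2 / c\<^sup>2 > 0 \<and> a > 0"
  unfolding K_plus_def by simp (metis A_mat_nth(1,2))

lemma K_plus_cond_iff:
  fixes c :: real
  assumes "c > 0"
  shows "a\<^sup>2 - b\<^sup>2 / c\<^sup>2 > 0 \<and> a > 0 \<longleftrightarrow> \<bar>b\<bar> < c * a"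
proof -
  have "a\<^sup>2 - b\<^sup>2 / c\<^sup>2 > 0 \<longleftrightarrow> b\<^sup>2 < (c * a)\<^sup>2"
    using assms by (simp add: field_simps)
  also have "\<dots> \<longleftrightarrow> \<bar>b\<bar> < \<bar>c * a\<bar>"
    by (metis abs_le_square_iff not_le)
  finally have iff: "a\<^sup>2 - b\<^sup>2 / c\<^sup>2 > 0 \<longleftrightarrow> \<bar>b\<bar> < \<bar>c * a\<bar>" .
  have "a > 0" if "\<bar>b\<bar> < c * a"
    using that assms by (smt (verit) mult_nonneg_nonpos)
  then show ?thesis
    unfolding iff using assms by (auto simp: abs_mult)
qed

lemma comm_group_K_plus:
  assumes "c > 0"
  shows "comm_group (K_plus c)"
proof (rule comm_groupI)
  fix x y assume "x \<in> carrier (K_plus c)" "y \<in> carrier (K_plus c)"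
  then obtain a b a' b' where x: "x = A_mat c a b" "a\<^sup>2 - b\<^sup>2 / c\<^sup>2 > 0" "a > 0"
    and y: "y = A_mat c a' b'" "a'\<^sup>2 - b'\<^sup>2 / c\<^sup>2 > 0" "a' > 0"
    by (auto simp: K_plus_def)
  have "\<bar>b\<bar> < c * a" "\<bar>b'\<bar> < c * a'"
    using x y K_plus_cond_iff[OF assms] by blast+
  then have "\<bar>b\<bar> * \<bar>b'\<bar> < (c * a) * (c * a')"
    by (intro mult_strict_mono') auto
  then have "- (b * b') < c\<^sup>2 * (a * a')"
    by (simp add: power2_eq_square mult_ac abs_mult[symmetric])
  then have "a * a' + b * b' / c\<^sup>2 > 0"
    using assms by (simp add: field_simps)
  moreover have "(a * a' + b * b' / c\<^sup>2)\<^sup>2 - (a * b' + b * a')\<^sup>2 / c\<^sup>2 > 0"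
    unfolding A_mat_norm_mult[OF assms] using x y by simp
  ultimately show "x \<otimes>\<^bsub>K_plus c\<^esub> y \<in> carrier (K_plus c)"
    unfolding x(1) y(1) by (auto simp: K_plus_def A_mat_mult)
  show "x \<otimes>\<^bsub>K_plus c\<^esub> y = y \<otimes>\<^bsub>K_plus c\<^esub> x"
    unfolding x(1) y(1) by (simp add: K_plus_def A_mat_mult algebra_simps)
next
  fix x assume "x \<in> carrier (K_plus c)"
  then obtain a b where x: "x = A_mat c a b" "a\<^sup>2 - b\<^sup>2 / c\<^sup>2 > 0" "a > 0"
    by (auto simp: K_plus_def)
  define d where "d = a\<^sup>2 - b\<^sup>2 / c\<^sup>2"
  have d: "d > 0" "a * a - b * b / c\<^sup>2 = d"
    using x by (simp_all add: d_def power2_eq_square)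
  have "(a / d)\<^sup>2 - (- b / d)\<^sup>2 / c\<^sup>2 = d / d\<^sup>2"
    by (simp add: d_def power_divide diff_divide_distrib)
  then have "A_mat c (a / d) (- b / d) \<in> carrier (K_plus c)"
    unfolding A_mat_in_K_plus using d(1) x(3) by simp
  moreover have "(a / d) * a + (- b / d) * b / c\<^sup>2 = (a * a - b * b / c\<^sup>2) / d"
    by (simp add: diff_divide_distrib)
  then have "(a / d) * a + (- b / d) * b / c\<^sup>2 = 1"
    using d by simp
  then have "A_mat c (a / d) (- b / d) ** x = mat 1"
    unfolding x(1) A_mat_mult by (simp add: A_mat_one)
  ultimately show "\<exists>y\<in>carrier (K_plus c). y \<otimes>\<^bsub>K_plus c\<^esub> x = \<one>\<^bsub>K_plus c\<^esub>"
    by (auto simp: K_plus_def)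
next
  show "\<one>\<^bsub>K_plus c\<^esub> \<in> carrier (K_plus c)"
    using A_mat_in_K_plus[of c 1 0] by (simp add: A_mat_one) (simp add: K_plus_def)
qed (simp_all add: K_plus_def matrix_mul_assoc)

lemma subspace_A_mat: "subspace {A_mat c a b | a b. True}"
proof (rule subspaceI)
  show "0 \<in> {A_mat c a b | a b. True}"
    by (auto simp: vec_eq_iff forall_2 intro!: exI[of _ 0])
next
  fix x y assume "x \<in> {A_mat c a b | a b. True}" "y \<in> {A_mat c a b | a b. True}"
  then obtain a b a' b' where "x = A_mat c a b" "y = A_mat c a' b'"
    by blast
  then have "x + y = A_mat c (a + a') (b + b')"
    by (simp add: vec_eq_iff forall_2 add_divide_distrib)
  then show "x + y \<in> {A_mat c a b | a b. True}"
    by blast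
next
  fix r x assume "x \<in> {A_mat c a b | a b. True}"
  then obtain a b where "x = A_mat c a b"
    by blast
  then have "r *\<^sub>R x = A_mat c (r * a) (r * b)"
    by (simp add: vec_eq_iff forall_2)
  then show "r *\<^sub>R x \<in> {A_mat c a b | a b. True}"
    by blast
qed

lemma openin_K_plus: "openin (top_of_set {A_mat c a b | a b. True}) (carrier (K_plus c))"
proof -
  have "open {x :: real^2^2. (x $ 1 $ 1)\<^sup>2 - (x $ 1 $ 2)\<^sup>2 / c\<^sup>2 > 0 \<and> x $ 1 $ 1 > 0}"
    unfolding divide_inverse
    by (intro open_Collect_conj open_Collect_less continuous_intros)
  moreover have "carrier (K_plus c) = {A_mat c a b | a b. True} \<inter>
      {x. (x $ 1 $ 1)\<^sup>2 - (x $ 1 $ 2)\<^sup>2 / c\<^sup>2 > 0 \<and> x $ 1 $ 1 > 0}"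
    by (auto simp: K_plus_def) blast
  ultimately show ?thesis
    unfolding openin_open by blast
qed

end

theory Submission imports Defs begin

text \<open>
  In the light-cone coordinates \<open>u = a + b / c\<close> and \<open>v = a - b / c\<close> the group \<open>K_plus c\<close> becomes
  the product of two copies of the multiplicative group of positive reals. A one-parametric
  subgroup is therefore a pair of differentiable homomorphisms from the additive to the
  multiplicative reals, that is, of exponentials \<open>exp (p * s)\<close> and \<open>exp (q * s)\<close>; the parameters
  are \<open>(p + q) / 2\<close> and \<open>(p - q) / 2\<close>.
\<close>

text \<open>Since \<open>f (t + x) = f t * f x\<close>, the derivative \<open>p\<close> at 0
  determines the derivative \<open>f t * p\<close> at every \<open>t\<close>. The integrating factor
  \<open>exp (- p * x)\<close> then gives a product with zero derivative, hence a constant.\<close>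

lemma differentiable_additive_to_multiplicative_eq_exp:
  fixes f :: "real \<Rightarrow> real"
  assumes diff: "f differentiable (at 0)"
    and zero: "f 0 = 1"
    and add: "\<And>x y. f (x + y) = f x * f y"
  obtains p where "\<And>x. f x = exp (p * x)"
proof -
  obtain p where p: "(f has_real_derivative p) (at 0)"
    using diff real_differentiable_def by blast
  have deriv: "(f has_real_derivative f t * p) (at t)" for t
  proof -
    have "((\<lambda>x. f t * f x) has_real_derivative f t * p) (at 0)"
      by (rule DERIV_cmult[OF p])
    then show ?thesis
      using DERIV_shift[of f "f t * p" 0 t] by (simp flip: add add: add.commute)
  qed
  have "((\<lambda>x. f x * exp (- p * x)) has_real_derivative 0) (at t)" for t
    by (auto intro!: derivative_eq_intros deriv)
  then have "f x * exp (- p * x) = f 0 * exp (- p * 0)" for x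
    by (intro DERIV_isconst_all) blast
  then have "f x = exp (p * x)" for x
    using zero by (simp add: exp_minus divide_inverse[symmetric])
  then show thesis
    by (rule that)
qed

lemma phi_eq_A_mat:
  assumes "c > 0"
  shows "phi c a b s = A_mat c (exp (a * s) * cosh (b * s)) (c * exp (a * s) * sinh (b * s))"
  using assms by (simp add: phi_def L_mat_def vec_eq_iff forall_2 power2_eq_square)

lemma phi_in_K_plus:
  assumes "c > 0"
  shows "phi c a b s \<in> carrier (K_plus c)"
proof -
  \<comment> \<open>By \<open>K_plus_cond_iff\<close>, membership is this inequality scaled by the
    positive factor \<open>c * exp (a * s)\<close>.\<close>
  have "\<bar>sinh (b * s)\<bar> < cosh (b * s)"
    using sinh_less_cosh_real[of "b * s"] sinh_less_cosh_real[of "- (b * s)"]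
    by (simp add: abs_less_iff)
  then have "\<bar>c * exp (a * s) * sinh (b * s)\<bar> < c * (exp (a * s) * cosh (b * s))"
    using assms by (simp add: abs_mult)
  then show ?thesis
    using assms by (simp only: phi_eq_A_mat A_mat_in_K_plus K_plus_cond_iff)
qed

lemma one_parametric_subgroup_K_plus_eq_phi:
  assumes c: "c > 0" and sub: "one_parametric_subgroup (K_plus c) \<phi>"
  shows "\<exists>a b. \<phi> = phi c a b"
proof -
  define \<alpha> \<beta> where "\<alpha> s = \<phi> s $ 1 $ 1" and "\<beta> s = \<phi> s $ 1 $ 2" for s
  have carrier: "\<phi> s \<in> carrier (K_plus c)" and mult: "\<phi> s ** \<phi> t = \<phi> (s + t)" for s t
    using sub by (auto simp: one_parametric_subgroup_def K_plus_def)
  have \<phi>: "\<phi> s = A_mat c (\<alpha> s) (\<beta> s)" for s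
    using carrier[of s] by (auto simp: K_plus_def \<alpha>_def \<beta>_def)
  have "A_mat c (\<alpha> (s + t)) (\<beta> (s + t)) =
      A_mat c (\<alpha> s * \<alpha> t + \<beta> s * \<beta> t / c\<^sup>2) (\<alpha> s * \<beta> t + \<beta> s * \<alpha> t)" for s t
    using mult[of s t] unfolding \<phi> A_mat_mult by simp
  then have \<alpha>_add: "\<alpha> (s + t) = \<alpha> s * \<alpha> t + \<beta> s * \<beta> t / c\<^sup>2"
    and \<beta>_add: "\<beta> (s + t) = \<alpha> s * \<beta> t + \<beta> s * \<alpha> t" for s t
    by (metis A_mat_nth(1), metis A_mat_nth(2))
  have "\<phi> 0 = mat 1"
    using sub by (simp add: one_parametric_subgroup_def K_plus_def)
  then have zero: "\<alpha> 0 = 1" "\<beta> 0 = 0"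
    by (simp_all add: \<alpha>_def \<beta>_def mat_def)
  \<comment> \<open>The instance \<open>n = 0\<close> of \<open>smooth_curve\<close>: the zeroth
    iterate is the curve itself.\<close>
  have "\<phi> differentiable (at 0)"
    using sub unfolding one_parametric_subgroup_def smooth_curve_def by (metis funpow_0)
  then obtain D where D: "(\<phi> has_derivative D) (at 0)"
    unfolding differentiable_def by blast
  have "(\<lambda>s. \<phi> s $ i $ j) differentiable (at 0)" for i j
    unfolding differentiable_def
    using bounded_linear.has_derivative[OF bounded_linear_vec_nth
        bounded_linear.has_derivative[OF bounded_linear_vec_nth D]] by blast
  then have diff: "\<alpha> differentiable (at 0)" "\<beta> differentiable (at 0)"
    unfolding \<alpha>_def \<beta>_def by blast+
  \<comment> \<open>The matrices \<open>A_mat c a b\<close> share the eigenvectors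
    \<open>(c, 1)\<close> and \<open>(c, -1)\<close>, with eigenvalues \<open>a + b / c\<close> and
    \<open>a - b / c\<close>. Each eigenvalue is therefore multiplicative, which is what
    \<open>\<alpha>_add\<close> and \<open>\<beta>_add\<close> yield here.\<close>
  obtain p where p: "\<alpha> s + \<beta> s / c = exp (p * s)" for s
    by (rule differentiable_additive_to_multiplicative_eq_exp[of "\<lambda>s. \<alpha> s + \<beta> s / c"])
      (use c in \<open>auto intro!: derivative_intros diff
        simp: zero \<alpha>_add \<beta>_add field_simps power2_eq_square\<close>)
  obtain q where q: "\<alpha> s - \<beta> s / c = exp (q * s)" for s
    by (rule differentiable_additive_to_multiplicative_eq_exp[of "\<lambda>s. \<alpha> s - \<beta> s / c"])
      (use c in \<open>auto intro!: derivative_intros diff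
        simp: zero \<alpha>_add \<beta>_add field_simps power2_eq_square\<close>)
  \<comment> \<open>Chosen so that \<open>p = a + b\<close> and \<open>q = a - b\<close>: the factor
    \<open>exp (a * s)\<close> splits off, and the half sum and half difference of the remaining
    exponentials are \<open>cosh (b * s)\<close> and \<open>sinh (b * s)\<close>.\<close>
  define a b where "a = (p + q) / 2" and "b = (p - q) / 2"
  have exps: "exp (p * s) = exp (a * s) * exp (b * s)"
    "exp (q * s) = exp (a * s) * exp (- (b * s))" for s
    by (simp_all add: a_def b_def field_simps flip: exp_add)
  have "\<alpha> s = exp (a * s) * cosh (b * s)" for s
    using p[of s] q[of s] unfolding exps by (simp add: cosh_def field_simps)
  moreover have "\<beta> s / c = exp (a * s) * sinh (b * s)" for s
    using p[of s] q[of s] unfolding exps by (simp add: sinh_def field_simps)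
  then have "\<beta> s = c * exp (a * s) * sinh (b * s)" for s
    using c by (simp add: field_simps)
  ultimately have "\<phi> = phi c a b"
    using c by (auto simp: \<phi> phi_eq_A_mat)
  then show ?thesis
    by blast
qed

theorem proposition12:
  fixes c :: real
  assumes "c > 0"
  shows "(\<forall>a b. phi c a b \<in> UNIV \<rightarrow> carrier (K_plus c)) \<and>
    (\<forall>\<phi>. one_parametric_subgroup (K_plus c) \<phi> \<longrightarrow> (\<exists>a b. \<phi> = phi c a b))"
  using phi_in_K_plus[OF assms] one_parametric_subgroup_K_plus_eq_phi[OF assms] by blast

end
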